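(* Fix a real number $\theta>1$. Let $G=(V,E)$ be a finite connected graph with edge set $E=\{e_1,\dots,e_m\}$, and let $\mathbf{w}_0=(w_{0,e})_{e\in E}$ be an initial weight vector with $w_{0,e}>0$ for all $e\in E$. Consider the discrete Ricci curvature flow with step size $s>0$, $$w_e^{(j+1)}=w_e^{(j)}-s\,\kappa_e^{(j)}w_e^{(j)},\qquad w_e^{(j)}>0,\qquad w_e^{(0)}=w_{0,e}. \quad ( * )$$ (i) If $\kappa$ is Ollivier's Ricci curvature, then for any $0<s<1$ the flow $( * )$ has a unique global solution $(w_e^{(j)})_{j\in\mathbb{N}}$ for all $e\in E$; moreover, when the (possible) $\theta$-surgery is performed at each iteration, for all $j\in\mathbb{N}$ and all edges $e$ remaining at iteration $j$, $$(1-s)^j w_{0,e}\le w_e^{(j)}\le (1-s+m\theta s)^j\sum_{\tau\in E}w_{0,\tau}.$$ (ii) If $\kappa$ is Lin-Lu-Yau's Ricci curvature, then for any $0<s<1/2$ the flow $( * )$ has a unique global solution $(w_e^{(j)})_{j\in\mathbb{N}}$ for all $e\in E$; moreover, when the (possible) $\theta$-surgery is performed at each iteration, for all $j\in\mathbb{N}$ and all edges $e$ remaining at iteration $j$, $$(1-2s)^j w_{0,e}\le w_e^{(j)}\le (1+2m\theta s)^j\sum_{\tau\in E}w_{0,\tau}.$$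
   Context: Graphs are finite, undirected, simple and connected, with at least one edge; $\mathbb{N}$ includes $0$; $m=|E|$ is the number of edges of the initial graph. For positive edge weights $\mathbf{w}=(w_e)_{e\in E}$ (write $w_{xy}=w_e$ for $e=xy$), the distance is $d(x,y)=\inf_\gamma\sum_{e\in\gamma}w_e$ over all paths $\gamma$ connecting $x$ and $y$. For an edge $e=xy$, $\rho_e=d(x,y)$ (so $\rho_e\le w_e$). For $\alpha\in[0,1]$ and $x\in V$, the $\alpha$-lazy one-step random walk is the probability measure with $\mu_x^\alpha(x)=\alpha$, $\mu_x^\alpha(z)=(1-\alpha)\,w_{xz}/\sum_{u\sim x}w_{xu}$ if $z\sim x$, and $\mu_x^\alpha(z)=0$ otherwise. For probability measures $\mu_1,\mu_2$ on $V$, the Wasserstein distance is $W(\mu_1,\mu_2)=\inf_A\sum_{u,v\in V}A(u,v)d(u,v)$ over all couplings $A:V\times V\to[0,1]$, i.e. $\sum_{x\in V}A(u,x)=\mu_1(u)$ and $\sum_{y\in V}A(y,v)=\mu_2(v)$ for all $u,v\in V$. Ollivier's Ricci curvature (for a fixed $\alpha$) on an edge $e=xy$ is $\kappa_e^\alpha=1-W(\mu_x^\alpha,\mu_y^\alpha)/\rho_e$; in statements about Ollivier's curvature, $\kappa_e=\kappa_e^\alpha$ for this fixed $\alpha$. Lin-Lu-Yau's Ricci curvature is $\kappa_e=\lim_{\alpha\to1^-}\kappa_e^\alpha/(1-\alpha)$. $\kappa_e^{(j)}$ and $\rho_e^{(j)}$ denote the curvature and the distance between the endpoints of $e$ computed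 from the weights $\mathbf{w}^{(j)}$ at iteration $j$ (both the random walks and the distance use $\mathbf{w}^{(j)}$). A global solution is a sequence of weight vectors $\mathbf{w}^{(j)}$, $j\in\mathbb{N}$, with all entries positive, satisfying the recursion and the initial condition. $\theta$-surgery on a weighted graph $(V,E,\mathbf{w})$: every edge $e$ with $w_e/\rho_e>\theta$ is removed from $E$; if there is no such edge, $E$ is unchanged. (Since $\theta>1$, removed edges lie on no shortest path, so distances and connectedness are unaffected.) The flow with $\theta$-surgery at each iteration is: put $E^{(-1)}=E$, $w_e^{(0)}=w_{0,e}$; for each $j\ge0$, let $E^{(j)}$ be the edge set obtained from $(V,E^{(j-1)},\mathbf{w}^{(j)})$ by $\theta$-surgery, compute $\rho_e^{(j)}$ and $\kappa_e^{(j)}$ on $(V,E^{(j)},(w_e^{(j)})_{e\in E^{(j)}})$, and define $w_e^{(j+1)}$ for $e\in E^{(j)}$ by the recursion. The edges remaining at iteration $j$ are those in $E^{(j)}$. *)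

theory Defs
  imports Complex_Main "HOL-Library.FuncSet"
begin

text \<open>
  Edges are two-element sets of vertices, so a weight vector on the edge set \<open>E\<close> is a function
  \<open>'a set \<Rightarrow> real\<close> of which only the values on \<open>E\<close> matter.
\<close>

definition simple_path :: "'a set set \<Rightarrow> 'a \<Rightarrow> 'a \<Rightarrow> 'a list \<Rightarrow> bool" where
  "simple_path E x y p \<longleftrightarrow>
     p \<noteq> [] \<and> hd p = x \<and> last p = y \<and> distinct p \<and> successively (\<lambda>u v. {u, v} \<in> E) p"

definition finite_connected_graph :: "'a set \<Rightarrow> 'a set set \<Rightarrow> bool" where
  "finite_connected_graph V E \<longleftrightarrow>
     finite V \<and> E \<noteq> {} \<and>
     (\<forall>e\<in>E. e \<subseteq> V \<and> card e = 2) \<and>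
     (\<forall>x\<in>V. \<forall>y\<in>V. \<exists>p. simple_path E x y p)"

definition path_length :: "('a set \<Rightarrow> real) \<Rightarrow> 'a list \<Rightarrow> real" where
  "path_length w p = (\<Sum>e \<leftarrow> map2 (\<lambda>u v. {u, v}) p (tl p). w e)"

definition graph_dist :: "'a set set \<Rightarrow> ('a set \<Rightarrow> real) \<Rightarrow> 'a \<Rightarrow> 'a \<Rightarrow> real" where
  "graph_dist E w x y = (INF p\<in>{p. simple_path E x y p}. path_length w p)"

definition lazy_walk :: "'a set set \<Rightarrow> ('a set \<Rightarrow> real) \<Rightarrow> real \<Rightarrow> 'a \<Rightarrow> 'a \<Rightarrow> real" where
  "lazy_walk E w \<alpha> x z =
     (if z = x then \<alpha>
      else if {x, z} \<in> E then (1 - \<alpha>) * w {x, z} / (\<Sum>u\<in>{u. {x, u} \<in> E}. w {x, u})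
      else 0)"

definition coupling ::
  "'a set \<Rightarrow> ('a \<Rightarrow> real) \<Rightarrow> ('a \<Rightarrow> real) \<Rightarrow> ('a \<Rightarrow> 'a \<Rightarrow> real) \<Rightarrow> bool" where
  "coupling V \<mu>1 \<mu>2 A \<longleftrightarrow>
     (\<forall>u\<in>V. \<forall>v\<in>V. A u v \<in> {0..1}) \<and>
     (\<forall>u\<in>V. (\<Sum>x\<in>V. A u x) = \<mu>1 u) \<and>
     (\<forall>v\<in>V. (\<Sum>y\<in>V. A y v) = \<mu>2 v)"

definition wasserstein ::
  "'a set \<Rightarrow> ('a \<Rightarrow> 'a \<Rightarrow> real) \<Rightarrow> ('a \<Rightarrow> real) \<Rightarrow> ('a \<Rightarrow> real) \<Rightarrow> real" where
  "wasserstein V d \<mu>1 \<mu>2 = (INF A\<in>{A. coupling V \<mu>1 \<mu>2 A}. \<Sum>u\<in>V. \<Sum>v\<in>V. A u v * d u v)"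

text \<open>
  The value at the edge \<open>e = {x, y}\<close> of a quantity \<open>f x y\<close>. It is only used for functions that are
  symmetric in the two endpoints; see the lemma \<open>on_edge_eq\<close> and the symmetry lemmas below.
\<close>

definition on_edge :: "('a \<Rightarrow> 'a \<Rightarrow> real) \<Rightarrow> 'a set \<Rightarrow> real" where
  "on_edge f e = (THE r. \<exists>x y. e = {x, y} \<and> r = f x y)"

definition edge_dist :: "'a set set \<Rightarrow> ('a set \<Rightarrow> real) \<Rightarrow> 'a set \<Rightarrow> real" where
  "edge_dist E w = on_edge (graph_dist E w)"

definition ollivier_curvature ::
  "'a set \<Rightarrow> real \<Rightarrow> 'a set set \<Rightarrow> ('a set \<Rightarrow> real) \<Rightarrow> 'a set \<Rightarrow> real" where
  "ollivier_curvature V \<alpha> E w =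
     on_edge (\<lambda>x y. 1 - wasserstein V (graph_dist E w) (lazy_walk E w \<alpha> x) (lazy_walk E w \<alpha> y)
                        / graph_dist E w x y)"

definition lin_lu_yau_curvature ::
  "'a set \<Rightarrow> 'a set set \<Rightarrow> ('a set \<Rightarrow> real) \<Rightarrow> 'a set \<Rightarrow> real" where
  "lin_lu_yau_curvature V E w e =
     Lim (at_left 1) (\<lambda>\<alpha>. ollivier_curvature V \<alpha> E w e / (1 - \<alpha>))"

text \<open>
  In the flows, \<open>\<kappa> E w e\<close> is the curvature of the edge \<open>e\<close> in the graph with edge set \<open>E\<close> and
  weights \<open>w\<close>. The extensional function space makes weight vectors on \<open>E\<close> equal as soon as they
  agree on \<open>E\<close>, so that uniqueness of solutions can be expressed by \<open>\<exists>!\<close>.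
\<close>

definition global_solution ::
  "('a set set \<Rightarrow> ('a set \<Rightarrow> real) \<Rightarrow> 'a set \<Rightarrow> real) \<Rightarrow> real \<Rightarrow> 'a set set \<Rightarrow> ('a set \<Rightarrow> real)
     \<Rightarrow> (nat \<Rightarrow> 'a set \<Rightarrow> real) \<Rightarrow> bool" where
  "global_solution \<kappa> s E w0 w \<longleftrightarrow>
     (\<forall>j. w j \<in> E \<rightarrow>\<^sub>E {0<..}) \<and>
     (\<forall>e\<in>E. w 0 e = w0 e) \<and>
     (\<forall>j. \<forall>e\<in>E. w (Suc j) e = w j e - s * \<kappa> E (w j) e * w j e)"

definition surgery :: "real \<Rightarrow> 'a set set \<Rightarrow> ('a set \<Rightarrow> real) \<Rightarrow> 'a set set" where
  "surgery \<theta> E w = E - {e\<in>E. w e / edge_dist E w e > \<theta>}"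

text \<open>
  The \<open>j\<close>-th state consists of the edge set after the surgery of iteration \<open>j\<close> and of the weights
  \<open>w\<close> of iteration \<open>j\<close>. The latter are still defined on the edge set before that surgery.
\<close>

primrec surgery_flow ::
  "('a set set \<Rightarrow> ('a set \<Rightarrow> real) \<Rightarrow> 'a set \<Rightarrow> real) \<Rightarrow> real \<Rightarrow> real \<Rightarrow> 'a set set
     \<Rightarrow> ('a set \<Rightarrow> real) \<Rightarrow> nat \<Rightarrow> 'a set set \<times> ('a set \<Rightarrow> real)" where
  "surgery_flow \<kappa> \<theta> s E w0 0 = (surgery \<theta> E w0, w0)"
| "surgery_flow \<kappa> \<theta> s E w0 (Suc j) =
     (let (F, w) = surgery_flow \<kappa> \<theta> s E w0 j;
          w' = (\<lambda>e\<in>F. w e - s * \<kappa> F w e * w e)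
      in (surgery \<theta> F w', w'))"

definition remaining_edges ::
  "('a set set \<Rightarrow> ('a set \<Rightarrow> real) \<Rightarrow> 'a set \<Rightarrow> real) \<Rightarrow> real \<Rightarrow> real \<Rightarrow> 'a set set
     \<Rightarrow> ('a set \<Rightarrow> real) \<Rightarrow> nat \<Rightarrow> 'a set set" where
  "remaining_edges \<kappa> \<theta> s E w0 j = fst (surgery_flow \<kappa> \<theta> s E w0 j)"

definition surgery_weights ::
  "('a set set \<Rightarrow> ('a set \<Rightarrow> real) \<Rightarrow> 'a set \<Rightarrow> real) \<Rightarrow> real \<Rightarrow> real \<Rightarrow> 'a set set
     \<Rightarrow> ('a set \<Rightarrow> real) \<Rightarrow> nat \<Rightarrow> 'a set \<Rightarrow> real" where
  "surgery_weights \<kappa> \<theta> s E w0 j = snd (surgery_flow \<kappa> \<theta> s E w0 j)"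

lemma on_edge_eq:
  assumes "\<And>x y. f x y = f y x"
  shows "on_edge f {x, y} = f x y"
  unfolding on_edge_def
  by (rule the_equality) (use assms in \<open>auto simp: doubleton_eq_iff\<close>)

lemma simple_path_rev: "simple_path E x y p \<Longrightarrow> simple_path E y x (rev p)"
  by (simp add: simple_path_def hd_rev last_rev insert_commute)

lemma path_length_Cons_Cons: "path_length w (x # y # p) = w {x, y} + path_length w (y # p)"
  by (simp add: path_length_def)

lemma path_length_snoc:
  "p \<noteq> [] \<Longrightarrow> path_length w (p @ [y]) = path_length w p + w {last p, y}"
proof (induction p rule: induct_list012)
  case (3 a b p)
  then show ?case by (simp add: path_length_Cons_Cons)
qed (simp_all add: path_length_def)

lemma path_length_rev: "path_length w (rev p) = path_length w p"
proof (induction p rule: induct_list012)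
  case (3 a b p)
  then show ?case
    using path_length_snoc[of "rev (b # p)" w a]
    by (simp add: path_length_Cons_Cons insert_commute)
qed (simp_all add: path_length_def)

lemma graph_dist_commute: "graph_dist E w x y = graph_dist E w y x"
proof -
  have "path_length w ` {p. simple_path E x y p} \<subseteq> path_length w ` {p. simple_path E y x p}"
    for x y :: 'a
  proof
    fix r assume "r \<in> path_length w ` {p. simple_path E x y p}"
    then obtain p where "simple_path E x y p" "r = path_length w p" by blast
    then have "simple_path E y x (rev p)" "r = path_length w (rev p)"
      by (simp_all add: simple_path_rev path_length_rev)
    then show "r \<in> path_length w ` {p. simple_path E y x p}" by blast
  qed
  then have "path_length w ` {p. simple_path E x y p} = path_length w ` {p. simple_path E y x p}"
    by (simp add: subset_antisym)
  then show ?thesis by (simp add: graph_dist_def)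
qed

lemma wasserstein_commute:
  assumes d: "\<And>u v. d u v = d v u"
  shows "wasserstein V d \<mu>1 \<mu>2 = wasserstein V d \<mu>2 \<mu>1"
proof -
  let ?c = "\<lambda>A. \<Sum>u\<in>V. \<Sum>v\<in>V. A u v * d u v"
  have "?c ` {A. coupling V \<mu>1 \<mu>2 A} \<subseteq> ?c ` {A. coupling V \<mu>2 \<mu>1 A}" for \<mu>1 \<mu>2
  proof
    fix r assume "r \<in> ?c ` {A. coupling V \<mu>1 \<mu>2 A}"
    then obtain A where A: "coupling V \<mu>1 \<mu>2 A" "r = ?c A" by blast
    have "coupling V \<mu>2 \<mu>1 (\<lambda>u v. A v u)" using A(1) by (simp add: coupling_def)
    moreover have "r = ?c (\<lambda>u v. A v u)"
      unfolding A(2) by (subst sum.swap) (simp add: d)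
    ultimately show "r \<in> ?c ` {A. coupling V \<mu>2 \<mu>1 A}"
      by (intro image_eqI[where x = "\<lambda>u v. A v u"]) simp_all
  qed
  then have "?c ` {A. coupling V \<mu>1 \<mu>2 A} = ?c ` {A. coupling V \<mu>2 \<mu>1 A}"
    by (simp add: subset_antisym)
  then show ?thesis by (simp add: wasserstein_def)
qed

lemma edge_dist_eq: "edge_dist E w {x, y} = graph_dist E w x y"
  unfolding edge_dist_def by (rule on_edge_eq) (rule graph_dist_commute)

lemma ollivier_curvature_eq:
  "ollivier_curvature V \<alpha> E w {x, y} =
     1 - wasserstein V (graph_dist E w) (lazy_walk E w \<alpha> x) (lazy_walk E w \<alpha> y)
           / graph_dist E w x y"
  unfolding ollivier_curvature_def
  by (rule on_edge_eq) (metis graph_dist_commute wasserstein_commute)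

end

theory Submission
  imports Defs
begin

text \<open>
  Both curvatures satisfy a two-sided bound \<open>1 - (\<Sum>\<tau>\<in>E. w \<tau>) / \<rho> \<le> \<kappa> \<le> c\<close>, where \<open>c = 1\<close> for
  Ollivier's and \<open>c = 2\<close> for Lin-Lu-Yau's curvature. The lower bound holds because no distance
  exceeds the total weight. The upper bound \<open>1\<close> is \<open>W \<ge> 0\<close>; the upper bound \<open>2\<close> holds because
  every coupling of the two \<open>\<alpha>\<close>-lazy walks puts mass at least \<open>2 * \<alpha> - 1\<close> on the pair of
  endpoints. Mixing an optimal coupling with the point mass at this pair shows that
  \<open>\<kappa>\<^sup>\<alpha> / (1 - \<alpha>)\<close> increases with \<open>\<alpha>\<close>, so that the Lin-Lu-Yau limit exists. The upper bound on
  \<open>\<kappa>\<close> keeps the weights positive and bounds them from below. Surgery ensures \<open>w \<le> \<theta> * \<rho>\<close>, and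
  the lower bound on \<open>\<kappa>\<close> then controls the growth of the total weight.
\<close>

section \<open>Paths and distances\<close>

abbreviation path_edges :: "'a list \<Rightarrow> 'a set list" where
  "path_edges p \<equiv> map2 (\<lambda>u v. {u, v}) p (tl p)"

lemma set_path_edges_subset: "successively (\<lambda>u v. {u, v} \<in> E) p \<Longrightarrow> set (path_edges p) \<subseteq> E"
  by (induction p rule: induct_list012) auto

lemma path_edges_vertices: "e \<in> set (path_edges p) \<Longrightarrow> e \<subseteq> set p"
  by (induction p rule: induct_list012) auto

text \<open>Turns the length of a simple path into a sum over a set of edges, which can be compared
  with sums over \<open>E\<close>.\<close>

lemma distinct_path_edges: "distinct p \<Longrightarrow> distinct (path_edges p)"
proof (induction p rule: induct_list012)
  case (3 a b p)
  have "{a, b} \<notin> set (path_edges (b # p))"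
  proof
    assume "{a, b} \<in> set (path_edges (b # p))"
    then have "{a, b} \<subseteq> set (b # p)" by (rule path_edges_vertices)
    with "3.prems" show False by simp
  qed
  with 3 show ?case by simp
qed simp_all

lemma successively_path_edges:
  "successively (\<lambda>u v. {u, v} \<in> set (path_edges p)) p"
proof (induction p rule: induct_list012)
  case (3 a b p)
  have "successively (\<lambda>u v. {u, v} \<in> set (path_edges (a # b # p))) (b # p)"
    by (rule successively_mono[OF "3.IH"(2)]) auto
  then show ?case by simp
qed simp_all

lemma path_vertices:
  "successively (\<lambda>u v. {u, v} \<in> E) p \<Longrightarrow> set p \<subseteq> insert (hd p) (\<Union>E)"
  by (induction p rule: induct_list012) auto

lemma successively_imp_rtranclp:
  "successively R p \<Longrightarrow> p \<noteq> [] \<Longrightarrow> R\<^sup>*\<^sup>* (hd p) (last p)"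
  by (induction p rule: induct_list012) (auto intro: converse_rtranclp_into_rtranclp)

text \<open>Loop erasure: when the new vertex already lies on the path, the suffix starting there
  replaces the whole path.\<close>

lemma rtranclp_imp_simple_path:
  assumes "(\<lambda>u v. {u, v} \<in> E)\<^sup>*\<^sup>* x y"
  shows "\<exists>p. simple_path E x y p"
  using assms
proof (induction rule: converse_rtranclp_induct)
  case base
  have "simple_path E y y [y]" by (simp add: simple_path_def)
  then show ?case ..
next
  case (step x z)
  then obtain p where p: "simple_path E z y p" by blast
  show ?case
  proof (cases "x \<in> set p")
    case True
    then obtain ps qs where "p = ps @ x # qs" by (meson split_list)
    with p have "simple_path E x y (x # qs)"
      by (auto simp: simple_path_def successively_append_iff)
    then show ?thesis ..
  next
    case False
    with p step(1) have "simple_path E x y (x # p)"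
      by (auto simp: simple_path_def successively_Cons)
    then show ?thesis ..
  qed
qed

text \<open>\<open>V\<close> stays fixed along the flow while \<open>E\<close> and \<open>w\<close>
  change, so every iteration is a new instance. Being an instance is the invariant that the flow has
  to preserve.\<close>

locale weighted_graph =
  fixes V :: "'a set" and E :: "'a set set" and w :: "'a set \<Rightarrow> real"
  assumes graph: "finite_connected_graph V E"
    and weight_pos: "e \<in> E \<Longrightarrow> 0 < w e"
begin

lemma finite_V: "finite V"
  and edge_subset: "e \<in> E \<Longrightarrow> e \<subseteq> V"
  and edge_card: "e \<in> E \<Longrightarrow> card e = 2"
  and connected: "x \<in> V \<Longrightarrow> y \<in> V \<Longrightarrow> \<exists>p. simple_path E x y p"
  using graph by (auto simp: finite_connected_graph_def)

lemma finite_E: "finite E"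
  using finite_subset[of E "Pow V"] finite_V edge_subset by auto

lemma edge_endpoints: "{x, y} \<in> E \<Longrightarrow> x \<in> V \<and> y \<in> V \<and> x \<noteq> y"
  using edge_subset[of "{x, y}"] edge_card[of "{x, y}"] by auto

lemma edge_cases:
  assumes "e \<in> E"
  obtains x y where "e = {x, y}"
  using edge_card[OF assms] by (auto simp: card_2_iff)

lemma finite_simple_paths: "finite {p. simple_path E x y p}"
proof (rule finite_subset)
  \<comment> \<open>\<open>x\<close> is inserted because \<open>[x]\<close> is a simple path even
    for \<open>x\<close> outside \<open>V\<close>.\<close>
  show "{p. simple_path E x y p} \<subseteq> {p. set p \<subseteq> insert x V \<and> distinct p}"
    using path_vertices edge_subset by (fastforce simp: simple_path_def)
  show "finite {p. set p \<subseteq> insert x V \<and> distinct p}"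
    using finite_V by (intro finite_subset_distinct) simp
qed

lemma path_length_eq_sum:
  "simple_path E x y p \<Longrightarrow> path_length w p = sum w (set (path_edges p))"
  unfolding path_length_def simple_path_def
  by (intro sum_list_distinct_conv_sum_set distinct_path_edges) simp

lemma path_edges_in_E: "simple_path E x y p \<Longrightarrow> set (path_edges p) \<subseteq> E"
  by (rule set_path_edges_subset) (simp add: simple_path_def)

lemma edge_le_path_length:
  assumes "simple_path E x y p" "e \<in> set (path_edges p)"
  shows "w e \<le> path_length w p"
  unfolding path_length_eq_sum[OF assms(1)]
  using assms path_edges_in_E[OF assms(1)] weight_pos
  by (intro member_le_sum) (auto intro: less_imp_le)

lemma path_length_le_total:
  assumes "simple_path E x y p"
  shows "path_length w p \<le> sum w E"
  unfolding path_length_eq_sum[OF assms]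
  using finite_E path_edges_in_E[OF assms] weight_pos
  by (intro sum_mono2) (auto intro: less_imp_le)

lemma graph_dist_le: "simple_path E x y p \<Longrightarrow> graph_dist E w x y \<le> path_length w p"
  unfolding graph_dist_def
  by (intro cINF_lower bdd_below_finite finite_imageI finite_simple_paths) simp

lemma graph_dist_attained:
  assumes "x \<in> V" "y \<in> V"
  obtains p where "simple_path E x y p" "path_length w p = graph_dist E w x y"
proof -
  let ?L = "path_length w ` {p. simple_path E x y p}"
  have "finite ?L" by (intro finite_imageI finite_simple_paths)
  moreover have "?L \<noteq> {}" using connected[OF assms] by blast
  ultimately have "Inf ?L \<in> ?L" by (simp add: cInf_eq_Min)
  then show ?thesis using that by (auto simp: graph_dist_def)
qed

lemma graph_dist_nonneg:
  assumes "x \<in> V" "y \<in> V"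
  shows "0 \<le> graph_dist E w x y"
proof -
  obtain p where p: "simple_path E x y p" "path_length w p = graph_dist E w x y"
    using graph_dist_attained[OF assms] .
  have "0 \<le> sum w (set (path_edges p))"
    using path_edges_in_E[OF p(1)] weight_pos by (intro sum_nonneg) (auto intro: less_imp_le)
  then show ?thesis using p path_length_eq_sum by simp
qed

lemma graph_dist_pos:
  assumes "x \<in> V" "y \<in> V" "x \<noteq> y"
  shows "0 < graph_dist E w x y"
proof -
  obtain p where p: "simple_path E x y p" "path_length w p = graph_dist E w x y"
    using graph_dist_attained[OF assms(1,2)] .
  obtain a b q where "p = a # b # q"
    \<comment> \<open>Distinct endpoints force a first edge; \<open>remdups_adj.cases\<close> only
      splits lists by length 0, 1 or at least 2.\<close>
    using p(1) assms(3) by (cases p rule: remdups_adj.cases) (auto simp: simple_path_def)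
  then have e: "{a, b} \<in> set (path_edges p)" by simp
  then have "0 < w {a, b}" using path_edges_in_E[OF p(1)] weight_pos by blast
  also have "\<dots> \<le> path_length w p" using edge_le_path_length[OF p(1) e] .
  finally show ?thesis using p(2) by simp
qed

lemma edge_dist_pos:
  assumes "e \<in> E"
  shows "0 < edge_dist E w e"
proof -
  obtain x y where "e = {x, y}" using assms by (rule edge_cases)
  with assms show ?thesis using edge_endpoints graph_dist_pos by (auto simp: edge_dist_eq)
qed

lemma graph_dist_le_total:
  assumes "x \<in> V" "y \<in> V"
  shows "graph_dist E w x y \<le> sum w E"
  using graph_dist_attained[OF assms] path_length_le_total by metis

end

section \<open>Surgery\<close>

context weighted_graph
begin

text \<open>
  By induction on the weight: a shortest path between the endpoints of a removed edge consists of
  strictly lighter edges.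
\<close>

lemma surgery_reaches_endpoints:
  assumes "1 \<le> \<theta>" "{x, y} \<in> E"
  shows "(\<lambda>u v. {u, v} \<in> surgery \<theta> E w)\<^sup>*\<^sup>* x y"
  using assms(2)
\<comment> \<open>The order on real weights is not well-founded, so the induction runs on the number
  of edges strictly lighter than the given one.\<close>
proof (induction "card {f \<in> E. w f < w {x, y}}" arbitrary: x y rule: less_induct)
  case less
  let ?R = "\<lambda>u v. {u, v} \<in> surgery \<theta> E w"
  show ?case
  proof (cases "{x, y} \<in> surgery \<theta> E w")
    case True
    then show ?thesis by (rule r_into_rtranclp)
  next
    case False
    let ?d = "graph_dist E w x y"
    note xy = edge_endpoints[OF less.prems]
    have pos: "0 < ?d" using xy graph_dist_pos by blast
    have "\<theta> < w {x, y} / ?d"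
      using False less.prems by (simp add: surgery_def edge_dist_eq not_less)
    with assms(1) have "1 < w {x, y} / ?d" by linarith
    then have lt: "?d < w {x, y}" using pos by (simp add: less_divide_eq)
    obtain p where p: "simple_path E x y p" "path_length w p = ?d"
      using graph_dist_attained xy by metis
    have step: "?R\<^sup>*\<^sup>* u v" if uv: "{u, v} \<in> set (path_edges p)" for u v
    proof -
      have E: "{u, v} \<in> E" using uv path_edges_in_E[OF p(1)] by blast
      have "w {u, v} < w {x, y}"
        using edge_le_path_length[OF p(1) uv] p(2) lt by simp
      then have "{f \<in> E. w f < w {u, v}} \<subset> {f \<in> E. w f < w {x, y}}"
        using E by auto
      then have "card {f \<in> E. w f < w {u, v}} < card {f \<in> E. w f < w {x, y}}"
        using finite_E by (intro psubset_card_mono) auto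
      then show ?thesis using less.hyps E by blast
    qed
    have "successively ?R\<^sup>*\<^sup>* p"
      by (rule successively_mono[OF successively_path_edges]) (rule step)
    then have "?R\<^sup>*\<^sup>*\<^sup>*\<^sup>* x y"
      using successively_imp_rtranclp[of "?R\<^sup>*\<^sup>*" p] p(1) by (auto simp: simple_path_def)
    then show ?thesis by simp
  qed
qed

text \<open>Each edge of an old path is replaced by a walk that survives the surgery; loop erasure
  makes the result simple again.\<close>

lemma surgery_connected_graph:
  assumes "1 \<le> \<theta>"
  shows "finite_connected_graph V (surgery \<theta> E w)"
proof -
  let ?R = "\<lambda>u v. {u, v} \<in> surgery \<theta> E w"
  have sub: "surgery \<theta> E w \<subseteq> E" by (auto simp: surgery_def)
  have reach: "?R\<^sup>*\<^sup>* x y" if xy: "x \<in> V" "y \<in> V" for x y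
  proof -
    obtain p where p: "simple_path E x y p" using connected[OF xy] by blast
    then have "successively ?R\<^sup>*\<^sup>* p"
      using successively_mono[of "\<lambda>u v. {u, v} \<in> E" p "?R\<^sup>*\<^sup>*"]
        surgery_reaches_endpoints[OF assms] by (auto simp: simple_path_def)
    then have "?R\<^sup>*\<^sup>*\<^sup>*\<^sup>* x y"
      using successively_imp_rtranclp[of "?R\<^sup>*\<^sup>*" p] p by (auto simp: simple_path_def)
    then show ?thesis by simp
  qed
  \<comment> \<open>Joining two distinct vertices takes at least one edge, so surgery cannot remove
    every edge.\<close>
  obtain e where e: "e \<in> E" using graph by (auto simp: finite_connected_graph_def)
  then obtain x y where "e = {x, y}" by (rule edge_cases)
  with e have "?R\<^sup>*\<^sup>* x y" "x \<noteq> y" using reach edge_endpoints by auto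
  then have "surgery \<theta> E w \<noteq> {}" by (auto elim: converse_rtranclpE)
  then show ?thesis
    using sub finite_V edge_subset edge_card rtranclp_imp_simple_path[OF reach]
    unfolding finite_connected_graph_def by blast
qed

lemma weighted_graph_surgery:
  assumes "1 \<le> \<theta>"
  shows "weighted_graph V (surgery \<theta> E w) w"
  using surgery_connected_graph[OF assms] weight_pos
  by unfold_locales (auto simp: surgery_def)

text \<open>Deleting edges leaves fewer paths, so the infimum can only grow. This carries the bound
  w \<le> \<theta> \<rho> from the distance before surgery, which decides on removal, to the
  distance after it, which enters the curvature.\<close>

lemma edge_dist_le_subgraph:
  assumes "weighted_graph V F w" "F \<subseteq> E" "e \<in> F"
  shows "edge_dist E w e \<le> edge_dist F w e"
proof -
  interpret F: weighted_graph V F w by fact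
  obtain x y where e: "e = {x, y}" using assms(3) by (rule F.edge_cases)
  then obtain p where p: "simple_path F x y p" "path_length w p = graph_dist F w x y"
    using F.graph_dist_attained F.edge_endpoints assms(3) by metis
  have "simple_path E x y p"
    using p(1) assms(2) by (auto simp: simple_path_def elim: successively_mono)
  then show ?thesis using graph_dist_le p(2) by (metis e edge_dist_eq)
qed

lemma weight_le_after_surgery:
  assumes "1 \<le> \<theta>" "e \<in> surgery \<theta> E w"
  shows "w e \<le> \<theta> * edge_dist (surgery \<theta> E w) w e"
proof -
  have e: "e \<in> E" "w e / edge_dist E w e \<le> \<theta>" using assms(2) by (auto simp: surgery_def)
  then have "w e \<le> \<theta> * edge_dist E w e"
    using edge_dist_pos[of e] by (simp add: pos_divide_le_eq)
  also have "\<dots> \<le> \<theta> * edge_dist (surgery \<theta> E w) w e"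
    using edge_dist_le_subgraph[OF weighted_graph_surgery[OF assms(1)] _ assms(2)] assms(1)
    by (intro mult_left_mono) (auto simp: surgery_def)
  finally show ?thesis .
qed

end

section \<open>Couplings of lazy walks\<close>

context weighted_graph
begin

lemma lazy_walk_self: "lazy_walk E w \<alpha> x x = \<alpha>"
  by (simp add: lazy_walk_def)

lemma lazy_walk_nonneg:
  assumes "0 \<le> \<alpha>" "\<alpha> \<le> 1"
  shows "0 \<le> lazy_walk E w \<alpha> x z"
  unfolding lazy_walk_def using assms weight_pos
  by (auto intro!: divide_nonneg_nonneg mult_nonneg_nonneg sum_nonneg intro: less_imp_le)

lemma neighbours: "{u. {x, u} \<in> E} \<subseteq> V - {x}"
  using edge_endpoints by blast

text \<open>Makes the normalising sum of the walk positive. Edges have two endpoints, so some vertex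
  differs from \<open>x\<close>, and a path to it leaves \<open>x\<close> along an edge.\<close>

lemma has_neighbour:
  assumes "x \<in> V"
  shows "{u. {x, u} \<in> E} \<noteq> {}"
proof -
  obtain e where e: "e \<in> E" using graph by (auto simp: finite_connected_graph_def)
  then obtain a b where ab: "e = {a, b}" by (rule edge_cases)
  then obtain y where y: "y \<in> V" "y \<noteq> x" using e edge_endpoints by metis
  obtain p where "simple_path E x y p" using connected[OF assms y(1)] by blast
  with y(2) show ?thesis by (cases p rule: remdups_adj.cases) (auto simp: simple_path_def)
qed

lemma sum_lazy_walk:
  assumes "x \<in> V"
  shows "(\<Sum>z\<in>V. lazy_walk E w \<alpha> x z) = 1"
proof -
  let ?N = "{u. {x, u} \<in> E}"
  have fin: "finite ?N" using neighbours finite_V by (meson finite_Diff finite_subset)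
  have pos: "0 < (\<Sum>u\<in>?N. w {x, u})"
    using fin has_neighbour[OF assms] weight_pos by (intro sum_pos) auto
  have "(\<Sum>z\<in>V. lazy_walk E w \<alpha> x z) = \<alpha> + (\<Sum>z\<in>V - {x}. lazy_walk E w \<alpha> x z)"
    using assms finite_V by (simp add: sum.remove lazy_walk_self)
  also have "(\<Sum>z\<in>V - {x}. lazy_walk E w \<alpha> x z) = (\<Sum>z\<in>?N. lazy_walk E w \<alpha> x z)"
    using neighbours finite_V by (intro sum.mono_neutral_right) (auto simp: lazy_walk_def)
  also have "\<dots> = (\<Sum>z\<in>?N. (1 - \<alpha>) * w {x, z} / (\<Sum>u\<in>?N. w {x, u}))"
    using neighbours by (intro sum.cong) (auto simp: lazy_walk_def)
  also have "\<dots> = 1 - \<alpha>"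
    using pos by (simp flip: sum_distrib_left sum_divide_distrib)
  finally show ?thesis by simp
qed

text \<open>All jump probabilities carry the factor 1 - \<alpha>, so scaling the walk by
  \<open>t\<close> and adding mass 1 - t at its starting vertex yields another lazy walk.\<close>

lemma lazy_walk_mix:
  "lazy_walk E w (1 - t * (1 - \<alpha>)) x z
    = t * lazy_walk E w \<alpha> x z + (1 - t) * (if z = x then 1 else 0)"
  by (simp add: lazy_walk_def algebra_simps)

section \<open>Wasserstein distance between lazy walks\<close>

abbreviation coupling_cost :: "('a \<Rightarrow> 'a \<Rightarrow> real) \<Rightarrow> real" where
  "coupling_cost A \<equiv> \<Sum>u\<in>V. \<Sum>v\<in>V. A u v * graph_dist E w u v"

abbreviation W :: "real \<Rightarrow> 'a \<Rightarrow> 'a \<Rightarrow> real" where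
  "W \<alpha> x y \<equiv> wasserstein V (graph_dist E w) (lazy_walk E w \<alpha> x) (lazy_walk E w \<alpha> y)"

lemma coupling_cost_nonneg: "coupling V \<mu>1 \<mu>2 A \<Longrightarrow> 0 \<le> coupling_cost A"
  by (intro sum_nonneg mult_nonneg_nonneg) (auto simp: coupling_def graph_dist_nonneg)

lemma wasserstein_le_cost:
  assumes "coupling V \<mu>1 \<mu>2 A"
  shows "wasserstein V (graph_dist E w) \<mu>1 \<mu>2 \<le> coupling_cost A"
  unfolding wasserstein_def
  by (rule cINF_lower) (use assms coupling_cost_nonneg in \<open>auto intro!: bdd_belowI2[of _ 0]\<close>)

text \<open>Ensures that the infimum defining the Wasserstein distance ranges over a nonempty set,
  and provides the test coupling for \<open>W_le_total\<close>.\<close>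

lemma product_coupling:
  assumes "\<And>u. u \<in> V \<Longrightarrow> 0 \<le> \<mu>1 u" "\<And>u. u \<in> V \<Longrightarrow> 0 \<le> \<mu>2 u" "sum \<mu>1 V = 1" "sum \<mu>2 V = 1"
  shows "coupling V \<mu>1 \<mu>2 (\<lambda>u v. \<mu>1 u * \<mu>2 v)"
proof -
  have "\<mu>1 u \<le> 1" "\<mu>2 u \<le> 1" if "u \<in> V" for u
    using member_le_sum[of u V \<mu>1] member_le_sum[of u V \<mu>2] assms that finite_V by auto
  then show ?thesis
    using assms by (auto simp: coupling_def mult_le_one simp flip: sum_distrib_left sum_distrib_right)
qed

lemma lazy_walk_coupling_exists:
  assumes "0 \<le> \<alpha>" "\<alpha> \<le> 1" "x \<in> V" "y \<in> V"
  shows "coupling V (lazy_walk E w \<alpha> x) (lazy_walk E w \<alpha> y)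
           (\<lambda>u v. lazy_walk E w \<alpha> x u * lazy_walk E w \<alpha> y v)"
  using assms by (intro product_coupling lazy_walk_nonneg sum_lazy_walk)

lemma le_wasserstein_lazy_walk:
  assumes "0 \<le> \<alpha>" "\<alpha> \<le> 1" "x \<in> V" "y \<in> V"
    and "\<And>A. coupling V (lazy_walk E w \<alpha> x) (lazy_walk E w \<alpha> y) A \<Longrightarrow> c \<le> coupling_cost A"
  shows "c \<le> W \<alpha> x y"
  unfolding wasserstein_def
  using lazy_walk_coupling_exists[OF assms(1-4)] assms(5) by (intro cINF_greatest) auto

lemma W_nonneg:
  assumes "0 \<le> \<alpha>" "\<alpha> \<le> 1" "x \<in> V" "y \<in> V"
  shows "0 \<le> W \<alpha> x y"
  using assms by (intro le_wasserstein_lazy_walk coupling_cost_nonneg)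

lemma W_le_total:
  assumes "0 \<le> \<alpha>" "\<alpha> \<le> 1" "x \<in> V" "y \<in> V"
  shows "W \<alpha> x y \<le> sum w E"
proof -
  let ?A = "\<lambda>u v. lazy_walk E w \<alpha> x u * lazy_walk E w \<alpha> y v"
  have "W \<alpha> x y \<le> coupling_cost ?A"
    by (intro wasserstein_le_cost lazy_walk_coupling_exists assms)
  also have "\<dots> \<le> (\<Sum>u\<in>V. \<Sum>v\<in>V. ?A u v * sum w E)"
    using assms lazy_walk_nonneg graph_dist_le_total by (intro sum_mono mult_left_mono) auto
  also have "\<dots> = sum w E"
    using assms by (simp add: sum_lazy_walk flip: sum_distrib_left sum_distrib_right)
  finally show ?thesis .
qed

text \<open>Row \<open>x\<close> of a coupling has mass \<alpha>. What it sends to vertices other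
  than \<open>y\<close> is at most the mass 1 - \<alpha> that the second walk has there, so at least
  2 \<alpha> - 1 travels from \<open>x\<close> to \<open>y\<close>; all other costs are
  nonnegative.\<close>

lemma W_ge:
  assumes "0 \<le> \<alpha>" "\<alpha> \<le> 1" "x \<in> V" "y \<in> V"
  shows "(2 * \<alpha> - 1) * graph_dist E w x y \<le> W \<alpha> x y"
proof (rule le_wasserstein_lazy_walk[OF assms])
  fix A
  assume A: "coupling V (lazy_walk E w \<alpha> x) (lazy_walk E w \<alpha> y) A"
  have nonneg: "0 \<le> A u v" if "u \<in> V" "v \<in> V" for u v
    using A that by (auto simp: coupling_def)
  have row: "(\<Sum>v\<in>V. A x v) = \<alpha>" and col: "(\<Sum>u\<in>V. A u v) = lazy_walk E w \<alpha> y v" if "v \<in> V" for v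
    using A assms(3) that by (auto simp: coupling_def lazy_walk_self)
  have "\<alpha> = A x y + (\<Sum>v\<in>V - {y}. A x v)"
    using row[OF assms(4)] sum.remove[OF finite_V assms(4)] by metis
  also have "(\<Sum>v\<in>V - {y}. A x v) \<le> (\<Sum>v\<in>V - {y}. lazy_walk E w \<alpha> y v)"
    using col nonneg assms(3) finite_V by (intro sum_mono) (auto simp flip: col intro!: member_le_sum)
  also have "\<dots> = 1 - \<alpha>"
    using sum_lazy_walk[OF assms(4)] assms(4) finite_V by (simp add: sum_diff1 lazy_walk_self)
  finally have "2 * \<alpha> - 1 \<le> A x y" by simp
  then have "(2 * \<alpha> - 1) * graph_dist E w x y \<le> A x y * graph_dist E w x y"
    using graph_dist_nonneg assms by (intro mult_right_mono)
  also have "\<dots> \<le> (\<Sum>v\<in>V. A x v * graph_dist E w x v)"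
    using assms finite_V nonneg graph_dist_nonneg
    by (intro member_le_sum[where f = "\<lambda>v. A x v * graph_dist E w x v"]) auto
  also have "\<dots> \<le> coupling_cost A"
    using assms finite_V nonneg graph_dist_nonneg
    by (intro member_le_sum[where f = "\<lambda>u. \<Sum>v\<in>V. A u v * graph_dist E w u v"])
      (auto intro!: sum_nonneg)
  finally show "(2 * \<alpha> - 1) * graph_dist E w x y \<le> coupling_cost A" .
qed

text \<open>By \<open>lazy_walk_mix\<close>, a coupling mixed with the point mass at the pair (x, y)
  couples the lazier walks, and the point mass costs exactly the distance from \<open>x\<close> to
  \<open>y\<close>.\<close>

lemma W_mix_le:
  assumes "0 \<le> \<alpha>" "\<alpha> \<le> 1" "x \<in> V" "y \<in> V" and t: "0 < t" "t \<le> 1"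
  shows "W (1 - t * (1 - \<alpha>)) x y \<le> t * W \<alpha> x y + (1 - t) * graph_dist E w x y"
proof -
  let ?\<beta> = "1 - t * (1 - \<alpha>)"
  \<comment> \<open>The point mass at (x, y), written as nested conditionals so that
    \<open>sum.delta\<close> collapses the sums.\<close>
  let ?D = "\<lambda>u v. if v = y then if u = x then 1 else 0 else 0 :: real"
  \<comment> \<open>Solving for the distance at \<alpha> makes the claim a lower bound for an
    infimum, so it can be checked on an arbitrary coupling instead of an optimal one.\<close>
  have "(W ?\<beta> x y - (1 - t) * graph_dist E w x y) / t \<le> W \<alpha> x y"
  proof (rule le_wasserstein_lazy_walk[OF assms(1-4)])
    fix A
    assume A: "coupling V (lazy_walk E w \<alpha> x) (lazy_walk E w \<alpha> y) A"
    let ?B = "\<lambda>u v. t * A u v + (1 - t) * ?D u v"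
    have rows: "(\<Sum>v\<in>V. ?B u v) = lazy_walk E w ?\<beta> x u" if "u \<in> V" for u
      using A that assms(4) finite_V
      by (simp add: coupling_def lazy_walk_mix sum.distrib sum.delta flip: sum_distrib_left)
    have cols: "(\<Sum>u\<in>V. ?B u v) = lazy_walk E w ?\<beta> y v" if "v \<in> V" for v
      using A that assms(3) finite_V
      by (simp add: coupling_def lazy_walk_mix sum.distrib sum.delta flip: sum_distrib_left)
    have "?B u v \<in> {0..1}" if "u \<in> V" "v \<in> V" for u v
    proof -
      have "0 \<le> A u v" "A u v \<le> 1" using A that by (auto simp: coupling_def)
      then have "0 \<le> t * A u v" "t * A u v \<le> t" using t by (auto intro: mult_left_le)
      moreover have "0 \<le> (1 - t) * ?D u v" "(1 - t) * ?D u v \<le> 1 - t" using t by auto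
      ultimately show ?thesis unfolding atLeastAtMost_iff by linarith
    qed
    with rows cols have "coupling V (lazy_walk E w ?\<beta> x) (lazy_walk E w ?\<beta> y) ?B"
      by (simp add: coupling_def)
    then have "W ?\<beta> x y \<le> coupling_cost ?B" by (rule wasserstein_le_cost)
    also have "\<dots> = t * coupling_cost A + (1 - t) * coupling_cost ?D"
      by (simp add: distrib_right sum.distrib sum_distrib_left mult.assoc)
    also have "coupling_cost ?D = graph_dist E w x y"
      using assms(3,4) finite_V by (simp add: if_distrib[of "\<lambda>a. a * _"] sum.delta cong: if_cong)
    finally show "(W ?\<beta> x y - (1 - t) * graph_dist E w x y) / t \<le> coupling_cost A"
      using t by (simp add: divide_le_eq mult.commute)
  qed
  then show ?thesis using t by (simp add: divide_le_eq mult.commute)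
qed

end

section \<open>Curvature bounds\<close>

context weighted_graph
begin

lemma ollivier_curvature_le_1:
  assumes "0 \<le> \<alpha>" "\<alpha> \<le> 1" "e \<in> E"
  shows "ollivier_curvature V \<alpha> E w e \<le> 1"
proof -
  obtain x y where e: "e = {x, y}" using assms(3) by (rule edge_cases)
  with assms(3) edge_endpoints have "x \<in> V" "y \<in> V" by auto
  then show ?thesis
    using assms W_nonneg graph_dist_nonneg by (simp add: e ollivier_curvature_eq)
qed

text \<open>The factor 1 - \<alpha> is the point of this bound: it keeps the quotient in the
  Lin-Lu-Yau limit at most 2.\<close>

lemma ollivier_curvature_le_2:
  assumes "0 \<le> \<alpha>" "\<alpha> \<le> 1" "e \<in> E"
  shows "ollivier_curvature V \<alpha> E w e \<le> 2 * (1 - \<alpha>)"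
proof -
  obtain x y where e: "e = {x, y}" using assms(3) by (rule edge_cases)
  with assms(3) edge_endpoints have xy: "x \<in> V" "y \<in> V" "x \<noteq> y" by auto
  then have "2 * \<alpha> - 1 \<le> W \<alpha> x y / graph_dist E w x y"
    using W_ge[OF assms(1,2) xy(1,2)] graph_dist_pos[OF xy] by (simp add: le_divide_eq)
  then show ?thesis by (simp add: e ollivier_curvature_eq)
qed

lemma ollivier_curvature_ge:
  assumes "0 \<le> \<alpha>" "\<alpha> \<le> 1" "e \<in> E"
  shows "1 - sum w E / edge_dist E w e \<le> ollivier_curvature V \<alpha> E w e"
proof -
  obtain x y where e: "e = {x, y}" using assms(3) by (rule edge_cases)
  with assms(3) edge_endpoints have xy: "x \<in> V" "y \<in> V" "x \<noteq> y" by auto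
  then show ?thesis
    using W_le_total[OF assms(1,2) xy(1,2)] graph_dist_pos[OF xy]
    by (simp add: e ollivier_curvature_eq edge_dist_eq divide_right_mono)
qed

lemma ollivier_curvature_ratio_mono:
  assumes "0 \<le> \<alpha>" "\<alpha> \<le> \<beta>" "\<beta> < 1" "e \<in> E"
  shows "ollivier_curvature V \<alpha> E w e / (1 - \<alpha>) \<le> ollivier_curvature V \<beta> E w e / (1 - \<beta>)"
proof -
  obtain x y where e: "e = {x, y}" using assms(4) by (rule edge_cases)
  with assms(4) edge_endpoints have xy: "x \<in> V" "y \<in> V" "x \<noteq> y" by auto
  define d where "d = graph_dist E w x y"
  \<comment> \<open>The mixing weight for which the walk of laziness \<alpha> turns into the one of
    laziness \<beta>.\<close>
  define t where "t = (1 - \<beta>) / (1 - \<alpha>)"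
  have d: "0 < d" using graph_dist_pos[OF xy] by (simp add: d_def)
  have t: "0 < t" "t \<le> 1" and \<beta>: "1 - t * (1 - \<alpha>) = \<beta>"
    using assms by (auto simp: t_def)
  have "W \<beta> x y \<le> t * W \<alpha> x y + (1 - t) * d"
    using W_mix_le[OF assms(1) _ xy(1,2) t] assms \<beta> by (simp add: d_def)
  then have "W \<beta> x y / d \<le> (t * W \<alpha> x y + (1 - t) * d) / d"
    using d by (intro divide_right_mono) auto
  also have "\<dots> = t * (W \<alpha> x y / d) + (1 - t)"
    using d by (simp add: add_divide_distrib)
  \<comment> \<open>In 1 - W / d the summand 1 - t cancels and leaves \<open>t\<close> times the
    curvature at \<alpha>.\<close>
  finally have "t * ollivier_curvature V \<alpha> E w e \<le> ollivier_curvature V \<beta> E w e"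
    by (simp add: e ollivier_curvature_eq d_def[symmetric] algebra_simps)
  then show ?thesis
    using assms by (simp add: t_def field_simps)
qed

text \<open>\<open>Lim\<close> is meaningful only once a limit exists. The quotient is increasing
  and bounded by 2 on [0, 1), so it converges to its supremum.\<close>

lemma lin_lu_yau_curvature_tendsto:
  assumes "e \<in> E"
  shows "((\<lambda>\<alpha>. ollivier_curvature V \<alpha> E w e / (1 - \<alpha>)) \<longlongrightarrow> lin_lu_yau_curvature V E w e) (at_left 1)"
proof -
  define h where "h \<alpha> = ollivier_curvature V \<alpha> E w e / (1 - \<alpha>)" for \<alpha>
  have mono: "h \<alpha> \<le> h \<beta>" if "0 \<le> \<alpha>" "\<alpha> \<le> \<beta>" "\<beta> < 1" for \<alpha> \<beta>
    unfolding h_def using that assms by (rule ollivier_curvature_ratio_mono)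
  have le2: "h \<alpha> \<le> 2" if "0 \<le> \<alpha>" "\<alpha> < 1" for \<alpha>
    using ollivier_curvature_le_2[of \<alpha> e] that assms by (simp add: h_def divide_le_eq)
  then have bdd: "bdd_above (h ` {0..<1})" by (intro bdd_aboveI2[of _ _ 2]) auto
  have "(h \<longlongrightarrow> (SUP \<alpha>\<in>{0..<1}. h \<alpha>)) (at_left 1)"
  proof (rule order_tendstoI)
    fix a assume "a < (SUP \<alpha>\<in>{0..<1}. h \<alpha>)"
    then obtain \<alpha> where \<alpha>: "0 \<le> \<alpha>" "\<alpha> < 1" "a < h \<alpha>"
      using bdd by (subst (asm) less_cSUP_iff) auto
    \<comment> \<open>To the right of a point where \<open>h\<close> exceeds \<open>a\<close>,
      monotonicity keeps it above \<open>a\<close>.\<close>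
    have "eventually (\<lambda>\<beta>. \<beta> \<in> {\<alpha><..<1}) (at_left 1)"
      using \<alpha> by (intro eventually_at_leftI[of \<alpha>]) auto
    then show "eventually (\<lambda>\<beta>. a < h \<beta>) (at_left 1)"
      by eventually_elim (use \<alpha> mono in \<open>fastforce intro: less_le_trans\<close>)
  next
    fix a assume a: "(SUP \<alpha>\<in>{0..<1}. h \<alpha>) < a"
    have "eventually (\<lambda>\<beta>::real. \<beta> \<in> {0<..<1}) (at_left 1)"
      by (intro eventually_at_leftI[of 0]) auto
    then show "eventually (\<lambda>\<beta>. h \<beta> < a) (at_left 1)"
    proof eventually_elim
      case (elim \<beta>)
      then show ?case using cSUP_upper[OF _ bdd, of \<beta>] a by auto
    qed
  qed
  then show ?thesis
    using tendsto_Lim[of "at_left (1::real)" h] by (simp add: lin_lu_yau_curvature_def flip: h_def)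
qed

lemma lin_lu_yau_curvature_le_2:
  assumes "e \<in> E"
  shows "lin_lu_yau_curvature V E w e \<le> 2"
proof (rule tendsto_upperbound[OF lin_lu_yau_curvature_tendsto[OF assms]])
  have "eventually (\<lambda>\<alpha>::real. \<alpha> \<in> {0<..<1}) (at_left 1)"
    by (intro eventually_at_leftI[of 0]) auto
  then show "eventually (\<lambda>\<alpha>. ollivier_curvature V \<alpha> E w e / (1 - \<alpha>) \<le> 2) (at_left 1)"
    by eventually_elim (use ollivier_curvature_le_2 assms in \<open>auto simp: divide_le_eq\<close>)
qed simp

text \<open>The Ollivier bound is used at \<alpha> = 0, where the quotient is the curvature itself;
  monotonicity carries it to the limit. Dividing the bound at a general \<alpha> by 1 - \<alpha>
  could send it to minus infinity.\<close>

lemma lin_lu_yau_curvature_ge: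
  assumes "e \<in> E"
  shows "1 - sum w E / edge_dist E w e \<le> lin_lu_yau_curvature V E w e"
proof (rule tendsto_lowerbound[OF lin_lu_yau_curvature_tendsto[OF assms]])
  have "eventually (\<lambda>\<alpha>::real. \<alpha> \<in> {0<..<1}) (at_left 1)"
    by (intro eventually_at_leftI[of 0]) auto
  then show "eventually (\<lambda>\<alpha>. 1 - sum w E / edge_dist E w e
      \<le> ollivier_curvature V \<alpha> E w e / (1 - \<alpha>)) (at_left 1)"
  proof eventually_elim
    case (elim \<alpha>)
    have "1 - sum w E / edge_dist E w e \<le> ollivier_curvature V 0 E w e"
      using ollivier_curvature_ge[of 0] assms by simp
    also have "\<dots> \<le> ollivier_curvature V \<alpha> E w e / (1 - \<alpha>)"
      using ollivier_curvature_ratio_mono[of 0 \<alpha>] elim assms by simp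
    finally show ?case .
  qed
qed simp

end

section \<open>The flow\<close>

text \<open>Treats both curvatures at once, with \<open>c\<close> equal to 1 or 2. The bounds are
  demanded for every edge set over \<open>V\<close> because surgery changes it. The condition c s <
  1 keeps weights positive, and s \<le> 1 keeps the growth factor nonnegative.\<close>

locale bounded_curvature =
  fixes V :: "'a set" and \<kappa> :: "'a set set \<Rightarrow> ('a set \<Rightarrow> real) \<Rightarrow> 'a set \<Rightarrow> real" and c s :: real
  assumes curvature_le: "weighted_graph V E w \<Longrightarrow> e \<in> E \<Longrightarrow> \<kappa> E w e \<le> c"
    and curvature_ge:
      "weighted_graph V E w \<Longrightarrow> e \<in> E \<Longrightarrow> 1 - sum w E / edge_dist E w e \<le> \<kappa> E w e"
    and step: "0 < s" "s \<le> 1" "c * s < 1"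
begin

lemma step_ge:
  assumes "weighted_graph V E w" "e \<in> E"
  shows "(1 - c * s) * w e \<le> w e - s * \<kappa> E w e * w e"
proof -
  have "0 < w e" using assms by (rule weighted_graph.weight_pos)
  then have "s * \<kappa> E w e * w e \<le> s * c * w e"
    using curvature_le[OF assms] step by (intro mult_right_mono mult_left_mono) auto
  then show ?thesis by (simp add: algebra_simps)
qed

lemma step_pos:
  assumes "weighted_graph V E w" "e \<in> E"
  shows "0 < w e - s * \<kappa> E w e * w e"
proof -
  have "0 < w e" using assms by (rule weighted_graph.weight_pos)
  then have "0 < (1 - c * s) * w e" using step by simp
  then show ?thesis using step_ge[OF assms] by linarith
qed

text \<open>The lower curvature bound gives - s \<kappa> w \<le> - s w + s (w / \<rho>) S with S the
  total weight, and the hypothesis says w / \<rho> \<le> \<theta>.\<close>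

lemma step_le:
  assumes "weighted_graph V E w" "e \<in> E" "w e \<le> \<theta> * edge_dist E w e"
  shows "w e - s * \<kappa> E w e * w e \<le> (1 - s) * w e + s * \<theta> * sum w E"
proof -
  interpret weighted_graph V E w by fact
  have w: "0 < w e" and \<rho>: "0 < edge_dist E w e"
    using assms(2) weight_pos edge_dist_pos by auto
  have total: "0 \<le> sum w E" using weight_pos by (intro sum_nonneg) (auto intro: less_imp_le)
  have "s * w e * (1 - sum w E / edge_dist E w e) \<le> s * w e * \<kappa> E w e"
    using curvature_ge[OF assms(1,2)] w step by (intro mult_left_mono) auto
  moreover have "s * sum w E * (w e / edge_dist E w e) \<le> s * sum w E * \<theta>"
    using assms(3) \<rho> total step by (intro mult_left_mono) (auto simp: pos_divide_le_eq)
  ultimately show ?thesis by (simp add: algebra_simps)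
qed

text \<open>Each iterate is determined by the preceding one, so the only issue is positivity. It
  propagates because positive weights give a weighted graph, to which \<open>step_pos\<close>
  applies.\<close>

lemma ex1_global_solution:
  assumes "weighted_graph V E w0"
  shows "\<exists>!w. global_solution \<kappa> s E w0 w"
proof (rule ex_ex1I)
  \<comment> \<open>Restricting to \<open>E\<close> at every step selects the extensional
    representative that \<open>global_solution\<close> requires.\<close>
  define w where
    "w = rec_nat (restrict w0 E) (\<lambda>_ w. \<lambda>e\<in>E. w e - s * \<kappa> E w e * w e)"
  have w_0: "w 0 = restrict w0 E"
    and w_Suc: "w (Suc j) = (\<lambda>e\<in>E. w j e - s * \<kappa> E (w j) e * w j e)" for j
    by (simp_all add: w_def)
  have graph: "finite_connected_graph V E" using assms by (simp add: weighted_graph_def)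
  have pos: "\<forall>e\<in>E. 0 < w j e" for j
  proof (induction j)
    case 0
    then show ?case using assms by (simp add: w_0 weighted_graph_def)
  next
    case (Suc j)
    then have "weighted_graph V E (w j)" using graph by (simp add: weighted_graph_def)
    then show ?case using step_pos by (simp add: w_Suc)
  qed
  moreover have "w j \<in> extensional E" for j by (cases j) (simp_all add: w_0 w_Suc)
  ultimately have "global_solution \<kappa> s E w0 w"
    by (simp add: global_solution_def PiE_def w_0 w_Suc)
  then show "\<exists>w. global_solution \<kappa> s E w0 w" by blast
next
  fix w w'
  assume w: "global_solution \<kappa> s E w0 w" and w': "global_solution \<kappa> s E w0 w'"
  have "w j = w' j" for j
  proof (induction j)
    case 0
    show ?case
      by (rule PiE_ext[of _ E "\<lambda>_. {0<..}"]) (use w w' in \<open>auto simp: global_solution_def\<close>)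
  next
    case (Suc j)
    then show ?case
      by (intro PiE_ext[of _ E "\<lambda>_. {0<..}"]) (use w w' in \<open>auto simp: global_solution_def\<close>)
  qed
  then show "w = w'" ..
qed

text \<open>The invariant bounds the total weight rather than single weights, since
  \<open>step_le\<close> estimates a new weight through the old total. It also records w \<le>
  \<theta> \<rho> after surgery, the hypothesis of \<open>step_le\<close> at the next
  iteration.\<close>

lemma surgery_flow_bounds:
  assumes "weighted_graph V E w0" "1 \<le> \<theta>" "surgery_flow \<kappa> \<theta> s E w0 j = (F, w)"
  shows "weighted_graph V F w \<and> F \<subseteq> E
    \<and> (\<forall>e\<in>F. w e \<le> \<theta> * edge_dist F w e \<and> (1 - c * s) ^ j * w0 e \<le> w e)
    \<and> sum w F \<le> (1 - s + real (card E) * \<theta> * s) ^ j * sum w0 E"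
  using assms(3)
proof (induction j arbitrary: F w)
  case 0
  interpret weighted_graph V E w0 by fact
  have F: "F = surgery \<theta> E w0" and w: "w = w0" using 0 by auto
  have sub: "F \<subseteq> E" by (auto simp: F surgery_def)
  moreover have "sum w F \<le> sum w0 E"
    unfolding w using finite_E sub weight_pos by (intro sum_mono2) (auto intro: less_imp_le)
  ultimately show ?case
    using weighted_graph_surgery[OF assms(2)] weight_le_after_surgery[OF assms(2)]
    by (simp add: F w)
next
  case (Suc j)
  obtain F' u where flow: "surgery_flow \<kappa> \<theta> s E w0 j = (F', u)" by fastforce
  have w: "w = (\<lambda>e\<in>F'. u e - s * \<kappa> F' u e * u e)" and F: "F = surgery \<theta> F' w"
    using Suc.prems by (auto simp: flow Let_def)
  let ?q = "1 - s + real (card E) * \<theta> * s"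
  note IH = Suc.IH[OF flow]
  interpret u: weighted_graph V F' u using IH by blast
  \<comment> \<open>The new weights live on the edge set before their own surgery, so the surgery
    lemmas are applied on \<open>F'\<close>.\<close>
  interpret w: weighted_graph V F' w
    using u.graph step_pos[OF u.weighted_graph_axioms] by unfold_locales (simp_all add: w)
  have sub: "F \<subseteq> F'" by (auto simp: F surgery_def)
  have E: "finite E" using assms(1) by (rule weighted_graph.finite_E)
  have lower: "(1 - c * s) ^ Suc j * w0 e \<le> w e" if "e \<in> F" for e
  proof -
    have e: "e \<in> F'" using that sub by blast
    have "(1 - c * s) ^ Suc j * w0 e \<le> (1 - c * s) * u e"
      using IH e step by (simp add: mult.assoc mult_left_mono)
    also have "\<dots> \<le> w e" using step_ge[OF u.weighted_graph_axioms e] e by (simp add: w)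
    finally show ?thesis .
  qed
  have total: "0 \<le> sum u F'" using u.weight_pos by (intro sum_nonneg) (auto intro: less_imp_le)
  have "sum w F \<le> sum w F'"
    using u.finite_E sub w.weight_pos by (intro sum_mono2) (auto intro: less_imp_le)
  also have "\<dots> \<le> (\<Sum>e\<in>F'. (1 - s) * u e + s * \<theta> * sum u F')"
    using step_le[OF u.weighted_graph_axioms] IH by (intro sum_mono) (simp add: w)
  \<comment> \<open>Every edge contributes s \<theta> times the old total, which is where the number
    of edges enters the growth factor.\<close>
  also have "\<dots> = (1 - s + real (card F') * \<theta> * s) * sum u F'"
    by (simp add: sum.distrib distrib_right flip: sum_distrib_left)
  also have "\<dots> \<le> ?q * sum u F'"
    using card_mono[OF E, of F'] IH assms(2) step total
    by (intro mult_right_mono add_left_mono) auto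
  also have "\<dots> \<le> ?q * (?q ^ j * sum w0 E)"
    using IH assms(2) step by (intro mult_left_mono) auto
  finally have "sum w F \<le> ?q ^ Suc j * sum w0 E" by (simp add: mult.assoc)
  then show ?case
    using w.weighted_graph_surgery[OF assms(2)] w.weight_le_after_surgery[OF assms(2)]
      lower sub IH by (auto simp: F)
qed

lemma surgery_weights_bounds:
  assumes "weighted_graph V E w0" "1 \<le> \<theta>" "e \<in> remaining_edges \<kappa> \<theta> s E w0 j"
  shows "(1 - c * s) ^ j * w0 e \<le> surgery_weights \<kappa> \<theta> s E w0 j e"
    and "surgery_weights \<kappa> \<theta> s E w0 j e \<le> (1 - s + real (card E) * \<theta> * s) ^ j * sum w0 E"
proof -
  obtain F w where flow: "surgery_flow \<kappa> \<theta> s E w0 j = (F, w)" by fastforce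
  note bounds = surgery_flow_bounds[OF assms(1,2) flow]
  interpret weighted_graph V F w using bounds by blast
  have e: "e \<in> F" using assms(3) flow by (simp add: remaining_edges_def)
  then show "(1 - c * s) ^ j * w0 e \<le> surgery_weights \<kappa> \<theta> s E w0 j e"
    using bounds flow by (simp add: surgery_weights_def)
  have "w e \<le> sum w F"
    using e finite_E weight_pos by (intro member_le_sum) (auto intro: less_imp_le)
  then show "surgery_weights \<kappa> \<theta> s E w0 j e \<le> (1 - s + real (card E) * \<theta> * s) ^ j * sum w0 E"
    using bounds flow by (simp add: surgery_weights_def)
qed

end

section \<open>The two curvatures as instances\<close>

theorem theorem2p3:
  fixes V :: "'a set" and E :: "'a set set" and w0 :: "'a set \<Rightarrow> real" and \<theta> :: real
  assumes "\<theta> > 1"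
    and "finite_connected_graph V E"
    and "\<forall>e\<in>E. w0 e > 0"
  shows
    "(\<forall>\<alpha>\<in>{0..1}. \<forall>s. 0 < s \<and> s < 1 \<longrightarrow>
        (\<exists>!w. global_solution (ollivier_curvature V \<alpha>) s E w0 w) \<and>
        (\<forall>j. \<forall>e\<in>remaining_edges (ollivier_curvature V \<alpha>) \<theta> s E w0 j.
           (1 - s) ^ j * w0 e \<le> surgery_weights (ollivier_curvature V \<alpha>) \<theta> s E w0 j e \<and>
           surgery_weights (ollivier_curvature V \<alpha>) \<theta> s E w0 j e
             \<le> (1 - s + real (card E) * \<theta> * s) ^ j * (\<Sum>\<tau>\<in>E. w0 \<tau>))) \<and>
     (\<forall>s. 0 < s \<and> s < 1 / 2 \<longrightarrow>
        (\<exists>!w. global_solution (lin_lu_yau_curvature V) s E w0 w) \<and>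
        (\<forall>j. \<forall>e\<in>remaining_edges (lin_lu_yau_curvature V) \<theta> s E w0 j.
           (1 - 2 * s) ^ j * w0 e \<le> surgery_weights (lin_lu_yau_curvature V) \<theta> s E w0 j e \<and>
           surgery_weights (lin_lu_yau_curvature V) \<theta> s E w0 j e
             \<le> (1 + 2 * real (card E) * \<theta> * s) ^ j * (\<Sum>\<tau>\<in>E. w0 \<tau>)))"
proof (intro conjI ballI allI impI)
  fix \<alpha> s :: real
  assume "\<alpha> \<in> {0..1}" and "0 < s \<and> s < 1"
  then interpret bounded_curvature V "ollivier_curvature V \<alpha>" 1 s
    using weighted_graph.ollivier_curvature_le_1 weighted_graph.ollivier_curvature_ge
    by unfold_locales auto
  have G: "weighted_graph V E w0" using assms by (simp add: weighted_graph_def)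
  show "\<exists>!w. global_solution (ollivier_curvature V \<alpha>) s E w0 w"
    using G by (rule ex1_global_solution)
  fix j e
  assume e: "e \<in> remaining_edges (ollivier_curvature V \<alpha>) \<theta> s E w0 j"
  show "(1 - s) ^ j * w0 e \<le> surgery_weights (ollivier_curvature V \<alpha>) \<theta> s E w0 j e"
    and "surgery_weights (ollivier_curvature V \<alpha>) \<theta> s E w0 j e
           \<le> (1 - s + real (card E) * \<theta> * s) ^ j * (\<Sum>\<tau>\<in>E. w0 \<tau>)"
    using surgery_weights_bounds[OF G _ e] assms(1) by simp_all
next
  fix s :: real
  assume s: "0 < s \<and> s < 1 / 2"
  then interpret bounded_curvature V "lin_lu_yau_curvature V" 2 s
    using weighted_graph.lin_lu_yau_curvature_le_2 weighted_graph.lin_lu_yau_curvature_ge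
    by unfold_locales auto
  have G: "weighted_graph V E w0" using assms by (simp add: weighted_graph_def)
  show "\<exists>!w. global_solution (lin_lu_yau_curvature V) s E w0 w"
    using G by (rule ex1_global_solution)
  fix j e
  assume e: "e \<in> remaining_edges (lin_lu_yau_curvature V) \<theta> s E w0 j"
  show "(1 - 2 * s) ^ j * w0 e \<le> surgery_weights (lin_lu_yau_curvature V) \<theta> s E w0 j e"
    using surgery_weights_bounds[OF G _ e] assms(1) by simp
  have "0 \<le> real (card E) * \<theta> * s" using assms(1) s by simp
  \<comment> \<open>The common growth factor is below the one claimed here; s < 1/2 makes it
    nonnegative, as comparing powers requires.\<close>
  then have "(1 - s + real (card E) * \<theta> * s) ^ j \<le> (1 + 2 * real (card E) * \<theta> * s) ^ j"
    using s by (intro power_mono) (simp_all add: algebra_simps)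
  moreover have "0 \<le> sum w0 E" using assms(3) by (intro sum_nonneg) (auto intro: less_imp_le)
  ultimately have "(1 - s + real (card E) * \<theta> * s) ^ j * sum w0 E
      \<le> (1 + 2 * real (card E) * \<theta> * s) ^ j * sum w0 E"
    by (rule mult_right_mono)
  then show "surgery_weights (lin_lu_yau_curvature V) \<theta> s E w0 j e
      \<le> (1 + 2 * real (card E) * \<theta> * s) ^ j * (\<Sum>\<tau>\<in>E. w0 \<tau>)"
    using surgery_weights_bounds(2)[OF G _ e] assms(1) by simp
qed

end
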